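(* (Progress for EDC.) For every type $A$ and every closed term $M:\emptyset\vdash A$ of the EDC calculus, one of the following holds: 1. $M\longrightarrow M'$ for some $M'$; 2. $M$ is a value; 3. $M=\mathtt{blame}\,\ell$ for some blame label $\ell$.
   Context: EDC is a cast calculus with partially-eager "D" coercions. **Types.** Base types $b$: $\mathtt{Nat},\mathtt{Bool},\mathtt{Int},\mathtt{Unit},\bot$. Types: $A,B::=b\mid\,?\mid A\to B\mid A\times B\mid A+B$; atomic types $a::=b\mid\,?$; $\otimes$ ranges over $\{\to,\times,+\}$. Contexts are finite sequences of types; variables are de Bruijn indices (index $0$ is the last-added type). Primitive types $P::=b\mid b\to P$; each $b$ denotes a set (naturals, Booleans, integers, one-element set, empty set), $[\![b\to P]\!]$ is the set of functions $[\![b]\!]\to[\![P]\!]$. Blame labels range over a fixed set with an involution $\ell\mapsto\overline\ell$. *Consistency* $\sim$: $A\sim\,?$; $?\sim B$; $b\sim b$; $A\otimes B\sim A'\otimes B'$ if $A\sim A'$, $B\sim B'$. **Casts** are coercions $c,d:A\Rightarrow B$: $\mathsf{id}:a\Rightarrow a$; $A!:A\Rightarrow\,?$ for $A\ne\,?$; $B?^\ell:\,?\Rightarrow B$ for $B\neq\,?$; $c\to d:(A\to B)\Rightarrow(C\to D)$ for $c:C\Rightarrow A$, $d:B\Rightarrow D$; $c\times d:(A\times B)\Rightarrow(C\times D)$ and $c+d:(A+B)\Rightarrow(C+D)$ for $c:A\Rightarrow C$, $d:B\Rightarrow D$. *Inert*: $A!$. *Active*: all others. $\mathsf{coerce}(A,B,\ell):A\Rightarrow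 B$ for $A\sim B$: $\mathsf{coerce}(?,?,\ell)=\mathsf{id}$; for $B\ne\,?$, $\mathsf{coerce}(?,B,\ell)=B?^\ell$; for $A\ne\,?$, $\mathsf{coerce}(A,?,\ell)=A!$; $\mathsf{coerce}(b,b,\ell)=\mathsf{id}$; $\mathsf{coerce}(A\to B,A'\to B',\ell)=\mathsf{coerce}(A',A,\overline\ell)\to\mathsf{coerce}(B,B',\ell)$; $\mathsf{coerce}(A\otimes B,A'\otimes B',\ell)=\mathsf{coerce}(A,A',\ell)\otimes\mathsf{coerce}(B,B',\ell)$ for $\otimes\in\{\times,+\}$. **Terms** (intrinsically typed; $M:\Gamma\vdash A$): $\$k:P$ for $k\in[\![P]\!]$; $`x:A$ if $x$ has type $A$ in $\Gamma$; $\lambda M:A\to B$ if $M:\Gamma\cdot A\vdash B$; $L\,M:B$ if $L:A\to B$, $M:A$; $\mathtt{if}\,L\,M\,N:B$ if $L:\mathtt{Bool}$, $M,N:B$; $\mathtt{cons}\,M\,N:A\times B$; $\pi_iM:A_i$ if $M:A_1\times A_2$; $\mathtt{inl}[B]M:A+B$ if $M:A$; $\mathtt{inr}[A]M:A+B$ if $M:B$; $\mathtt{case}\,L\,M\,N:B$ if $L:A_1+A_2$, $M:A_1\to B$, $N:A_2\to B$; $M\langle c\rangle:B$ if $M:A$, $c:A\Rightarrow B$; $\mathtt{blame}\,\ell:A$ for every $A$. **Values** $V,W$: $\lambda M$; $\$k$; $\mathtt{cons}\,V\,W$; $\mathtt{inl}[B]V$; $\mathtt{inr}[A]V$; $V\langle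 A!\rangle$. **Frames** $F$: $\Box\,M$; $V\,\Box$; $\mathtt{if}\,\Box\,M\,N$; $\mathtt{cons}\,V\,\Box$; $\mathtt{cons}\,\Box\,N$; $\pi_i\Box$; $\mathtt{inl}[B]\Box$; $\mathtt{inr}[A]\Box$; $\mathtt{case}\,\Box\,M\,N$; $\Box\langle c\rangle$. **Reduction** ($M[V]$ is substitution for variable $0$; $\uparrow$ is weakening by one variable): - $F[M]\longrightarrow F[M']$ if $M\longrightarrow M'$; $F[\mathtt{blame}\,\ell]\longrightarrow\mathtt{blame}\,\ell$. - $V\langle\mathsf{id}\rangle\longrightarrow V$; $V\langle A!\rangle\langle B?^\ell\rangle\longrightarrow V\langle\mathsf{coerce}(A,B,\ell)\rangle$ if $A\sim B$, and $\longrightarrow\mathtt{blame}\,\ell$ otherwise. - $V\langle c\to d\rangle\longrightarrow\lambda(((\uparrow V)\,(`0\langle c\rangle))\langle d\rangle)$; $V\langle c\times d\rangle\longrightarrow\mathtt{cons}\,((\pi_1V)\langle c\rangle)\,((\pi_2V)\langle d\rangle)$; $V\langle c+d\rangle\longrightarrow\mathtt{case}\,V\,(\lambda\,\mathtt{inl}[D](`0\langle c\rangle))\,(\lambda\,\mathtt{inr}[C](`0\langle d\rangle))$ where the target of $c+d$ is $C+D$. - $(\lambda M)V\longrightarrow M[V]$; $\mathtt{if}\,\$\mathtt{true}\,M\,N\longrightarrow M$; $\mathtt{if}\,\$\mathtt{false}\,M\,N\longrightarrow N$; $\pi_1(\mathtt{cons}\,V\,W)\longrightarrow V$; $\pi_2(\mathtt{cons}\,V\,W)\longrightarrow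 W$; $\mathtt{case}(\mathtt{inl}[B]V)\,L\,M\longrightarrow L\,V$; $\mathtt{case}(\mathtt{inr}[A]V)\,L\,M\longrightarrow M\,V$; $\$k\,\$k'\longrightarrow\$(k(k'))$. *)

theory Defs
  imports "HOL-Library.FuncSet"
begin

class blame_label =
  fixes flip :: "'a \<Rightarrow> 'a"
  assumes flip_flip: "flip (flip l) = l"

datatype base = NatB | BoolB | IntB | UnitB | BotB

datatype ty =
    Base base
  | Unk  (* the type ? *)
  | Fun ty ty   (infixr "\<rightarrow>\<^sub>t" 70)
  | Prod ty ty  (infixr "\<times>\<^sub>t" 80)
  | Sum ty ty   (infixr "+\<^sub>t" 75)

type_synonym ctx = "ty list"

fun atomic :: "ty \<Rightarrow> bool" where
  "atomic (Base b) = True"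
| "atomic Unk = True"
| "atomic _ = False"

inductive consistent :: "ty \<Rightarrow> ty \<Rightarrow> bool"  (infix "\<sim>" 50) where
  "A \<sim> Unk"
| "Unk \<sim> B"
| "Base b \<sim> Base b"
| "A \<sim> A' \<Longrightarrow> B \<sim> B' \<Longrightarrow> A \<rightarrow>\<^sub>t B \<sim> A' \<rightarrow>\<^sub>t B'"
| "A \<sim> A' \<Longrightarrow> B \<sim> B' \<Longrightarrow> A \<times>\<^sub>t B \<sim> A' \<times>\<^sub>t B'"
| "A \<sim> A' \<Longrightarrow> B \<sim> B' \<Longrightarrow> A +\<^sub>t B \<sim> A' +\<^sub>t B'"

datatype prim = PBase base | PFun base prim

fun ty_of_prim :: "prim \<Rightarrow> ty" where
  "ty_of_prim (PBase b) = Base b"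
| "ty_of_prim (PFun b P) = Base b \<rightarrow>\<^sub>t ty_of_prim P"

text \<open>The sets denoted by the primitive types are subsets of one universe
  \<open>primval\<close>. A function on the set of a base type is encoded as an extensional
  function on all of \<open>baseval\<close>, so that each function has exactly one code.\<close>

datatype baseval = NatV nat | BoolV bool | IntV int | UnitV

datatype primval = BaseV baseval | FunV "baseval \<Rightarrow> primval"

fun base_den :: "base \<Rightarrow> baseval set" where
  "base_den NatB = range NatV"
| "base_den BoolB = range BoolV"
| "base_den IntB = range IntV"
| "base_den UnitB = {UnitV}"
| "base_den BotB = {}"

fun prim_den :: "prim \<Rightarrow> primval set" where
  "prim_den (PBase b) = BaseV ` base_den b"
| "prim_den (PFun b P) = FunV ` (base_den b \<rightarrow>\<^sub>E prim_den P)"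

datatype 'l coercion =
    Id ty
  | Inj ty
  | Proj ty 'l
  | CFun "'l coercion" "'l coercion"
  | CProd "'l coercion" "'l coercion"
  | CSum "'l coercion" "'l coercion"

inductive coercion_ty :: "'l coercion \<Rightarrow> ty \<Rightarrow> ty \<Rightarrow> bool"  ("_ : _ \<Rightarrow>\<^sub>c _" [51, 51, 51] 50) where
  "atomic a \<Longrightarrow> Id a : a \<Rightarrow>\<^sub>c a"
| "A \<noteq> Unk \<Longrightarrow> Inj A : A \<Rightarrow>\<^sub>c Unk"
| "B \<noteq> Unk \<Longrightarrow> Proj B l : Unk \<Rightarrow>\<^sub>c B"
| "c : C \<Rightarrow>\<^sub>c A \<Longrightarrow> d : B \<Rightarrow>\<^sub>c D \<Longrightarrow> CFun c d : A \<rightarrow>\<^sub>t B \<Rightarrow>\<^sub>c C \<rightarrow>\<^sub>t D"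
| "c : A \<Rightarrow>\<^sub>c C \<Longrightarrow> d : B \<Rightarrow>\<^sub>c D \<Longrightarrow> CProd c d : A \<times>\<^sub>t B \<Rightarrow>\<^sub>c C \<times>\<^sub>t D"
| "c : A \<Rightarrow>\<^sub>c C \<Longrightarrow> d : B \<Rightarrow>\<^sub>c D \<Longrightarrow> CSum c d : A +\<^sub>t B \<Rightarrow>\<^sub>c C +\<^sub>t D"

text \<open>Only meaningful for consistent types; the remaining cases are left unspecified.\<close>

function (sequential) coerce :: "ty \<Rightarrow> ty \<Rightarrow> 'l::blame_label \<Rightarrow> 'l coercion" where
  "coerce Unk Unk l = Id Unk"
| "coerce Unk B l = Proj B l"
| "coerce A Unk l = Inj A"
| "coerce (Base b) (Base b') l = (if b = b' then Id (Base b) else undefined)"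
| "coerce (A \<rightarrow>\<^sub>t B) (A' \<rightarrow>\<^sub>t B') l = CFun (coerce A' A (flip l)) (coerce B B' l)"
| "coerce (A \<times>\<^sub>t B) (A' \<times>\<^sub>t B') l = CProd (coerce A A' l) (coerce B B' l)"
| "coerce (A +\<^sub>t B) (A' +\<^sub>t B') l = CSum (coerce A A' l) (coerce B B' l)"
| "coerce _ _ _ = undefined"
  by pat_completeness auto
termination
  by (relation "measure (\<lambda>(A, B, l). size A + size B)") auto

text \<open>Terms carry enough type annotations (on constants, abstractions, injections,
  identity coercions and blame) that, in a given context, a term has at most one type
  and at most one typing derivation. Pairs of a term and a derivation thus
  correspond to intrinsically typed terms.\<close>

datatype 'l tm =
    Const prim primval
  | Var nat
  | Lam ty "'l tm"
  | App "'l tm" "'l tm"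
  | Cond "'l tm" "'l tm" "'l tm"
  | Tup "'l tm" "'l tm"
  | Fst "'l tm"
  | Snd "'l tm"
  | InL ty "'l tm"
  | InR ty "'l tm"
  | Case "'l tm" "'l tm" "'l tm"
  | Cast "'l tm" "'l coercion"
  | Blame ty 'l

inductive has_type :: "ctx \<Rightarrow> 'l tm \<Rightarrow> ty \<Rightarrow> bool"  ("_ \<turnstile> _ : _" [51, 51, 51] 50) where
  "k \<in> prim_den P \<Longrightarrow> \<Gamma> \<turnstile> Const P k : ty_of_prim P"
| "x < length \<Gamma> \<Longrightarrow> \<Gamma> \<turnstile> Var x : \<Gamma> ! x"
| "A # \<Gamma> \<turnstile> M : B \<Longrightarrow> \<Gamma> \<turnstile> Lam A M : A \<rightarrow>\<^sub>t B"
| "\<Gamma> \<turnstile> L : A \<rightarrow>\<^sub>t B \<Longrightarrow> \<Gamma> \<turnstile> M : A \<Longrightarrow> \<Gamma> \<turnstile> App L M : B"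
| "\<Gamma> \<turnstile> L : Base BoolB \<Longrightarrow> \<Gamma> \<turnstile> M : B \<Longrightarrow> \<Gamma> \<turnstile> N : B \<Longrightarrow> \<Gamma> \<turnstile> Cond L M N : B"
| "\<Gamma> \<turnstile> M : A \<Longrightarrow> \<Gamma> \<turnstile> N : B \<Longrightarrow> \<Gamma> \<turnstile> Tup M N : A \<times>\<^sub>t B"
| "\<Gamma> \<turnstile> M : A \<times>\<^sub>t B \<Longrightarrow> \<Gamma> \<turnstile> Fst M : A"
| "\<Gamma> \<turnstile> M : A \<times>\<^sub>t B \<Longrightarrow> \<Gamma> \<turnstile> Snd M : B"
| "\<Gamma> \<turnstile> M : A \<Longrightarrow> \<Gamma> \<turnstile> InL B M : A +\<^sub>t B"
| "\<Gamma> \<turnstile> M : B \<Longrightarrow> \<Gamma> \<turnstile> InR A M : A +\<^sub>t B"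
| "\<Gamma> \<turnstile> L : A +\<^sub>t A' \<Longrightarrow> \<Gamma> \<turnstile> M : A \<rightarrow>\<^sub>t B \<Longrightarrow> \<Gamma> \<turnstile> N : A' \<rightarrow>\<^sub>t B \<Longrightarrow> \<Gamma> \<turnstile> Case L M N : B"
| "\<Gamma> \<turnstile> M : A \<Longrightarrow> c : A \<Rightarrow>\<^sub>c B \<Longrightarrow> \<Gamma> \<turnstile> Cast M c : B"
| "\<Gamma> \<turnstile> Blame A l : A"

primrec lift :: "nat \<Rightarrow> 'l tm \<Rightarrow> 'l tm" where
  "lift n (Const P k) = Const P k"
| "lift n (Var x) = Var (if x < n then x else Suc x)"
| "lift n (Lam A M) = Lam A (lift (Suc n) M)"
| "lift n (App L M) = App (lift n L) (lift n M)"
| "lift n (Cond L M N) = Cond (lift n L) (lift n M) (lift n N)"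
| "lift n (Tup M N) = Tup (lift n M) (lift n N)"
| "lift n (Fst M) = Fst (lift n M)"
| "lift n (Snd M) = Snd (lift n M)"
| "lift n (InL B M) = InL B (lift n M)"
| "lift n (InR A M) = InR A (lift n M)"
| "lift n (Case L M N) = Case (lift n L) (lift n M) (lift n N)"
| "lift n (Cast M c) = Cast (lift n M) c"
| "lift n (Blame A l) = Blame A l"

primrec subst :: "nat \<Rightarrow> 'l tm \<Rightarrow> 'l tm \<Rightarrow> 'l tm" where
  "subst n V (Const P k) = Const P k"
| "subst n V (Var x) = (if x < n then Var x else if x = n then V else Var (x - 1))"
| "subst n V (Lam A M) = Lam A (subst (Suc n) (lift 0 V) M)"
| "subst n V (App L M) = App (subst n V L) (subst n V M)"
| "subst n V (Cond L M N) = Cond (subst n V L) (subst n V M) (subst n V N)"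
| "subst n V (Tup M N) = Tup (subst n V M) (subst n V N)"
| "subst n V (Fst M) = Fst (subst n V M)"
| "subst n V (Snd M) = Snd (subst n V M)"
| "subst n V (InL B M) = InL B (subst n V M)"
| "subst n V (InR A M) = InR A (subst n V M)"
| "subst n V (Case L M N) = Case (subst n V L) (subst n V M) (subst n V N)"
| "subst n V (Cast M c) = Cast (subst n V M) c"
| "subst n V (Blame A l) = Blame A l"

inductive is_value :: "'l tm \<Rightarrow> bool" where
  "is_value (Lam A M)"
| "is_value (Const P k)"
| "is_value V \<Longrightarrow> is_value W \<Longrightarrow> is_value (Tup V W)"
| "is_value V \<Longrightarrow> is_value (InL B V)"
| "is_value V \<Longrightarrow> is_value (InR A V)"
| "is_value V \<Longrightarrow> is_value (Cast V (Inj A))"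

text \<open>A frame is represented by the function that fills its hole.\<close>

inductive is_frame :: "('l tm \<Rightarrow> 'l tm) \<Rightarrow> bool" where
  "is_frame (\<lambda>X. App X M)"
| "is_value V \<Longrightarrow> is_frame (\<lambda>X. App V X)"
| "is_frame (\<lambda>X. Cond X M N)"
| "is_value V \<Longrightarrow> is_frame (\<lambda>X. Tup V X)"
| "is_frame (\<lambda>X. Tup X N)"
| "is_frame (\<lambda>X. Fst X)"
| "is_frame (\<lambda>X. Snd X)"
| "is_frame (\<lambda>X. InL B X)"
| "is_frame (\<lambda>X. InR A X)"
| "is_frame (\<lambda>X. Case X M N)"
| "is_frame (\<lambda>X. Cast X c)"

text \<open>The context and the typing premises serve only to determine the annotations
  on the right-hand sides.\<close>

inductive step :: "ctx \<Rightarrow> 'l::blame_label tm \<Rightarrow> 'l tm \<Rightarrow> bool"  ("_ \<turnstile> _ \<longmapsto> _" [51, 51, 51] 50)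
  for \<Gamma> :: ctx where
  "is_frame F \<Longrightarrow> \<Gamma> \<turnstile> M \<longmapsto> M' \<Longrightarrow> \<Gamma> \<turnstile> F M \<longmapsto> F M'"
| "is_frame F \<Longrightarrow> \<Gamma> \<turnstile> F (Blame A l) : B \<Longrightarrow> \<Gamma> \<turnstile> F (Blame A l) \<longmapsto> Blame B l"
| "is_value V \<Longrightarrow> \<Gamma> \<turnstile> Cast V (Id a) \<longmapsto> V"
| "is_value V \<Longrightarrow> A \<sim> B \<Longrightarrow>
    \<Gamma> \<turnstile> Cast (Cast V (Inj A)) (Proj B l) \<longmapsto> Cast V (coerce A B l)"
| "is_value V \<Longrightarrow> \<not> A \<sim> B \<Longrightarrow>
    \<Gamma> \<turnstile> Cast (Cast V (Inj A)) (Proj B l) \<longmapsto> Blame B l"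
| "is_value V \<Longrightarrow> CFun c d : A \<rightarrow>\<^sub>t B \<Rightarrow>\<^sub>c C \<rightarrow>\<^sub>t D \<Longrightarrow>
    \<Gamma> \<turnstile> Cast V (CFun c d) \<longmapsto> Lam C (Cast (App (lift 0 V) (Cast (Var 0) c)) d)"
| "is_value V \<Longrightarrow>
    \<Gamma> \<turnstile> Cast V (CProd c d) \<longmapsto> Tup (Cast (Fst V) c) (Cast (Snd V) d)"
| "is_value V \<Longrightarrow> CSum c d : A +\<^sub>t B \<Rightarrow>\<^sub>c C +\<^sub>t D \<Longrightarrow>
    \<Gamma> \<turnstile> Cast V (CSum c d) \<longmapsto>
      Case V (Lam A (InL D (Cast (Var 0) c))) (Lam B (InR C (Cast (Var 0) d)))"
| "is_value V \<Longrightarrow> \<Gamma> \<turnstile> App (Lam A M) V \<longmapsto> subst 0 V M"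
| "\<Gamma> \<turnstile> Cond (Const (PBase BoolBB) (BaseV (BoolV True))) M N \<longmapsto> M"
| "\<Gamma> \<turnstile> Cond (Const (PBase BoolBB) (BaseV (BoolV False))) M N \<longmapsto> N"
| "is_value V \<Longrightarrow> is_value W \<Longrightarrow> \<Gamma> \<turnstile> Fst (Tup V W) \<longmapsto> V"
| "is_value V \<Longrightarrow> is_value W \<Longrightarrow> \<Gamma> \<turnstile> Snd (Tup V W) \<longmapsto> W"
| "is_value V \<Longrightarrow> \<Gamma> \<turnstile> Case (InL B V) L M \<longmapsto> App L V"
| "is_value V \<Longrightarrow> \<Gamma> \<turnstile> Case (InR A V) L M \<longmapsto> App M V"
| "\<Gamma> \<turnstile> App (Const (PFun b P) (FunV f)) (Const (PBase b) (BaseV v)) \<longmapsto> Const P (f v)"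

end

(* Progress and preservation are proved together, by one induction on the typing derivation: each
   reduct is typed where it is constructed, so neither inversion of reduction nor uniqueness of
   types is needed. *)
theory Submission imports Defs begin

section \<open>Typing of the coercions produced by \<open>coerce\<close>\<close>

text \<open>Both directions are needed at once, since function coercions are contravariant.\<close>

lemma coerce_typed_both:
  "A \<sim> B \<Longrightarrow> coerce A B l : A \<Rightarrow>\<^sub>c B \<and> coerce B A l : B \<Rightarrow>\<^sub>c A"
proof (induction A B arbitrary: l rule: consistent.induct)
  case (1 A)
  then show ?case by (cases A) (auto intro: coercion_ty.intros)
next
  case (2 B)
  then show ?case by (cases B) (auto intro: coercion_ty.intros)
qed (auto intro: coercion_ty.intros)

lemmas coerce_typed = coerce_typed_both[THEN conjunct1]

section \<open>Weakening and substitution\<close>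

text \<open>The prefix \<open>\<Gamma>\<close> makes the statement inductive: it records the binders
  already crossed, and its length is the cutoff index. Crossing one more binder \<open>A\<close>
  instantiates it with \<open>A # \<Gamma>\<close>.\<close>

lemma lift_typed:
  "\<Gamma> @ \<Delta> \<turnstile> M : A \<Longrightarrow> \<Gamma> @ B # \<Delta> \<turnstile> lift (length \<Gamma>) M : A"
proof (induction "\<Gamma> @ \<Delta>" M A arbitrary: \<Gamma> rule: has_type.induct)
  case (2 x)
  then show ?case
    using has_type.intros(2)[of x "\<Gamma> @ B # \<Delta>"] has_type.intros(2)[of "Suc x" "\<Gamma> @ B # \<Delta>"]
    by (auto simp: nth_append Suc_diff_le)
next
  case (3 A M C)
  then show ?case
    using "3"(2)[of "A # \<Gamma>"] by (auto intro: has_type.intros)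
qed (auto intro: has_type.intros)

lemma subst_typed:
  "\<Gamma> @ B # \<Delta> \<turnstile> M : A \<Longrightarrow> \<Gamma> @ \<Delta> \<turnstile> V : B \<Longrightarrow> \<Gamma> @ \<Delta> \<turnstile> subst (length \<Gamma>) V M : A"
proof (induction "\<Gamma> @ B # \<Delta>" M A arbitrary: \<Gamma> V rule: has_type.induct)
  case (2 x)
  \<comment> \<open>An index above the removed entry is written \<open>Suc y\<close>, so that
    \<open>x - 1\<close> is a genuine predecessor and not the truncated
    \<open>0 - 1\<close>.\<close>
  consider "x < length \<Gamma>" | "x = length \<Gamma>" | y where "x = Suc y" "length \<Gamma> \<le> y"
    by (metis less_imp_Suc_add linorder_neqE_nat le_add1)
  then show ?case
    using 2 has_type.intros(2)[of x "\<Gamma> @ \<Delta>"] has_type.intros(2)[of "x - 1" "\<Gamma> @ \<Delta>"]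
    by cases (auto simp: nth_append Suc_diff_le)
next
  case (3 A M C)
  then show ?case
    \<comment> \<open>The induction generalizes over \<open>V\<close> because the substituted term
      changes under the binder; weakening by an empty prefix types \<open>lift 0 V\<close>
      there.\<close>
    using "3"(2)[of "A # \<Gamma>" "lift 0 V"] lift_typed[of "[]" "\<Gamma> @ \<Delta>" V B A]
    by (auto intro: has_type.intros)
qed (auto intro: has_type.intros)

section \<open>Canonical forms of values\<close>

text \<open>Excludes constants from the canonical forms at \<open>Unk\<close>, products and sums.
  Both orientations are simp rules, since simplification does not turn equations around.\<close>

lemma ty_of_prim_neq [simp]:
  "ty_of_prim P \<noteq> Unk" "ty_of_prim P \<noteq> A \<times>\<^sub>t B" "ty_of_prim P \<noteq> A +\<^sub>t B"
  "Unk \<noteq> ty_of_prim P" "A \<times>\<^sub>t B \<noteq> ty_of_prim P" "A +\<^sub>t B \<noteq> ty_of_prim P"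
  by (cases P; simp)+

lemma ty_of_prim_eq_Base: "ty_of_prim P = Base b \<longleftrightarrow> P = PBase b"
  by (cases P) auto

lemma ty_of_prim_eq_Fun:
  "ty_of_prim P = A \<rightarrow>\<^sub>t B \<longleftrightarrow> (\<exists>b Q. P = PFun b Q \<and> A = Base b \<and> B = ty_of_prim Q)"
  by (cases P) auto

inductive_cases value_CastE: "is_value (Cast V c)"
inductive_cases Inj_typedE: "Inj A : B \<Rightarrow>\<^sub>c C"

text \<open>The only casts that are values are injections, whose target is \<open>Unk\<close>. At
  any other type this leaves constants and the introduction forms. Variables are not values, so the
  context may be arbitrary.\<close>

lemma value_Base:
  assumes "is_value V" "\<Gamma> \<turnstile> V : Base b"
  obtains v where "V = Const (PBase b) (BaseV v)" "v \<in> base_den b"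
  using assms(2,1)
proof (cases rule: has_type.cases)
  case (1 k P)
  then show ?thesis
    using that by (auto dest!: ty_of_prim_eq_Base[THEN iffD1, OF sym])
qed (auto elim: is_value.cases Inj_typedE)

text \<open>Function coercions are active, so no wrapped function appears among the values: besides
  abstractions there are only primitive functions.\<close>

lemma value_Fun:
  assumes "is_value V" "\<Gamma> \<turnstile> V : A \<rightarrow>\<^sub>t B"
  obtains (Lam) M where "V = Lam A M" "A # \<Gamma> \<turnstile> M : B"
  | (Const) b P f where "V = Const (PFun b P) (FunV f)" "A = Base b" "B = ty_of_prim P"
      "f \<in> base_den b \<rightarrow>\<^sub>E prim_den P"
  using assms(2,1)
proof (cases rule: has_type.cases)
  case (1 k P)
  then show ?thesis
    using Const by (auto dest!: ty_of_prim_eq_Fun[THEN iffD1, OF sym])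
qed (auto elim: is_value.cases Inj_typedE Lam)

lemma value_Prod:
  assumes "is_value V" "\<Gamma> \<turnstile> V : A \<times>\<^sub>t B"
  obtains U W where "V = Tup U W" "is_value U" "is_value W" "\<Gamma> \<turnstile> U : A" "\<Gamma> \<turnstile> W : B"
  using assms(2,1)
  by (cases rule: has_type.cases) (auto elim: is_value.cases Inj_typedE)

lemma value_Sum:
  assumes "is_value V" "\<Gamma> \<turnstile> V : A +\<^sub>t B"
  obtains (InL) W where "V = InL B W" "is_value W" "\<Gamma> \<turnstile> W : A"
  | (InR) W where "V = InR A W" "is_value W" "\<Gamma> \<turnstile> W : B"
  using assms(2,1)
  by (cases rule: has_type.cases) (auto elim: is_value.cases Inj_typedE)

lemma value_Unk:
  assumes "is_value V" "\<Gamma> \<turnstile> V : Unk"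
  obtains A W where "V = Cast W (Inj A)" "is_value W" "\<Gamma> \<turnstile> W : A"
  using assms(2,1)
  by (cases rule: has_type.cases) (auto elim!: value_CastE Inj_typedE elim: is_value.cases)

section \<open>Typed reducts of frames, casts and applications\<close>

definition reduces :: "'l::blame_label tm \<Rightarrow> ty \<Rightarrow> bool" where
  "reduces M A \<longleftrightarrow> (\<exists>M'. [] \<turnstile> M' : A \<and> [] \<turnstile> M \<longmapsto> M')"

lemma reducesI: "[] \<turnstile> M \<longmapsto> M' \<Longrightarrow> [] \<turnstile> M' : A \<Longrightarrow> reduces M A"
  unfolding reduces_def by blast

text \<open>Covers congruence and blame propagation together. The last assumption plays the part of
  a typing judgement for the frame: it types the new reduct in the first case, and in the second, at
  \<open>N = Blame A l\<close>, it gives the typing premise that fixes the annotation of the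
  resulting blame.\<close>

lemma reduces_frame:
  assumes "reduces M A \<or> (\<exists>l. M = Blame A l)" "is_frame F"
    and "\<And>N. [] \<turnstile> N : A \<Longrightarrow> [] \<turnstile> F N : B"
  shows "reduces (F M) B"
  using assms step.intros(1,2)[OF assms(2)] has_type.intros(13)
  unfolding reduces_def by metis

lemmas frames = is_frame.intros
lemmas typing = has_type.intros

lemma Cast_reduces:
  assumes V: "is_value V" "[] \<turnstile> V : A" and c: "c : A \<Rightarrow>\<^sub>c B"
  shows "reduces (Cast V c) B \<or> is_value (Cast V c)"
  using c
proof cases
  case 1
  then show ?thesis using V by (auto intro: reducesI step.intros(3))
next
  case 2
  then show ?thesis using V by (auto intro: is_value.intros)
next
  case (3 l)
  then obtain C W where W: "V = Cast W (Inj C)" "is_value W" "[] \<turnstile> W : C"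
    using V value_Unk by metis
  \<comment> \<open>If \<open>C \<sim> B\<close>, the reduct is typed by
    \<open>coerce_typed\<close>; otherwise it is blame, which has every type.\<close>
  show ?thesis
    using 3 W step.intros(4)[of W C B "[]" l] step.intros(5)[of W C B "[]" l]
      typing(12)[OF W(3) coerce_typed] typing(13) reducesI by metis
next
  case (4 c' C A' d B' D)
  \<comment> \<open>The new parameter has the target domain \<open>C\<close>; \<open>c'\<close>
    takes it back to the source domain \<open>A'\<close> before \<open>V\<close> is applied, and
    \<open>d\<close> converts the result.\<close>
  have "[C] \<turnstile> lift 0 V : A' \<rightarrow>\<^sub>t B'" using lift_typed[of "[]" "[]"] V 4 by simp
  moreover have "[C] \<turnstile> Var 0 : C" using typing(2)[of 0 "[C]"] by simp
  ultimately have "[] \<turnstile> Lam C (Cast (App (lift 0 V) (Cast (Var 0) c')) d) : B"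
    using 4 by (auto intro!: typing intro: typing)
  then show ?thesis using step.intros(6)[OF V(1)] 4 c reducesI by metis
next
  case (5 c' A' C d B' D)
  then have "[] \<turnstile> Tup (Cast (Fst V) c') (Cast (Snd V) d) : B"
    using V by (auto intro: typing)
  then show ?thesis using step.intros(7)[OF V(1)] 5 reducesI by metis
next
  case (6 c' A' C d B' D)
  \<comment> \<open>Stated for every \<open>E\<close> because the two branches bind variables of
    different types, \<open>A'\<close> and \<open>B'\<close>.\<close>
  have "[E] \<turnstile> Var 0 : E" for E using typing(2)[of 0 "[E]"] by simp
  then have "[A'] \<turnstile> InL D (Cast (Var 0) c') : B" "[B'] \<turnstile> InR C (Cast (Var 0) d) : B"
    using 6 by (blast intro: typing)+
  then have "[] \<turnstile> Case V (Lam A' (InL D (Cast (Var 0) c'))) (Lam B' (InR C (Cast (Var 0) d))) : B"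
    using V 6 by (blast intro: typing)
  then show ?thesis using step.intros(8)[OF V(1)] 6 c reducesI by metis
qed

lemma App_reduces:
  assumes V: "is_value V" "[] \<turnstile> V : A \<rightarrow>\<^sub>t B" and W: "is_value W" "[] \<turnstile> W : A"
  shows "reduces (App V W) B"
  using V
proof (cases rule: value_Fun)
  case (Lam M)
  then show ?thesis
    using step.intros(9)[OF W(1)] subst_typed[of "[]" A "[]" M B W] W reducesI by fastforce
next
  case (Const b P f)
  obtain v where v: "W = Const (PBase b) (BaseV v)" "v \<in> base_den b"
    using W Const value_Base by metis
  \<comment> \<open>\<open>f\<close> lies in the extensional function space and \<open>v\<close> in
    its domain, so \<open>f v\<close> lies in \<open>prim_den P\<close>.\<close>
  then have "[] \<turnstile> Const P (f v) : B" using Const by (auto intro: typing)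
  then show ?thesis using Const v step.intros(16) reducesI by metis
qed

section \<open>Progress by induction on typing\<close>

lemma progress:
  "[] \<turnstile> M : A \<Longrightarrow> reduces M A \<or> is_value M \<or> (\<exists>l. M = Blame A l)"
proof (induction "[] :: ctx" M A rule: has_type.induct)
  case (4 L A B M)
  note M = 4(1,3) and IH = 4(2,4)
  \<comment> \<open>Evaluation is left to right: the frame around the argument is available only
    once \<open>L\<close> is a value.\<close>
  consider "is_value L" "is_value M" | "reduces L (A \<rightarrow>\<^sub>t B) \<or> (\<exists>l. L = Blame (A \<rightarrow>\<^sub>t B) l)"
    | "is_value L" "reduces M A \<or> (\<exists>l. M = Blame A l)" using IH by blast
  then show ?case
  proof cases
    case 1
    then show ?thesis using App_reduces M by blast
  next
    case 2
    from reduces_frame[OF this frames(1), of M B] M show ?thesis by (auto intro: typing)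
  next
    case 3
    from reduces_frame[OF this(2) frames(2)[OF this(1)], of B] M show ?thesis
      by (auto intro: typing)
  qed
next
  case (5 L M B N)
  consider "is_value L" | "reduces L (Base BoolB) \<or> (\<exists>l. L = Blame (Base BoolB) l)"
    using 5 by blast
  then show ?case
  proof cases
    case 1
    \<comment> \<open>The canonical form at \<open>BoolB\<close> carries an element of
      \<open>range BoolV\<close>, hence a Boolean \<open>b\<close> that selects the branch.\<close>
    then obtain b where "L = Const (PBase BoolB) (BaseV (BoolV b))"
      using 5(1) by (elim value_Base) auto
    then show ?thesis using 5 by (cases b) (auto intro: reducesI step.intros(10,11))
  next
    case 2
    from reduces_frame[OF this frames(3), of M N B] 5 show ?thesis by (auto intro: typing)
  qed
next
  case (6 M A N B)
  note M = 6(1,3) and IH = 6(2,4)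
  consider "is_value M" "is_value N" | "reduces M A \<or> (\<exists>l. M = Blame A l)"
    | "is_value M" "reduces N B \<or> (\<exists>l. N = Blame B l)" using IH by blast
  then show ?case
  proof cases
    case 1
    then show ?thesis by (auto intro: is_value.intros)
  next
    case 2
    from reduces_frame[OF this frames(5), of N "A \<times>\<^sub>t B"] M show ?thesis by (auto intro: typing)
  next
    case 3
    from reduces_frame[OF this(2) frames(4)[OF this(1)], of "A \<times>\<^sub>t B"] M show ?thesis
      by (auto intro: typing)
  qed
next
  case (7 M A B)
  consider "is_value M" | "reduces M (A \<times>\<^sub>t B) \<or> (\<exists>l. M = Blame (A \<times>\<^sub>t B) l)"
    using 7 by blast
  then show ?case
  proof cases
    case 1
    then show ?thesis using 7(1) step.intros(12) value_Prod reducesI by metis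
  next
    case 2
    from reduces_frame[OF this frames(6), of A] show ?thesis by (auto intro: typing)
  qed
next
  case (8 M A B)
  consider "is_value M" | "reduces M (A \<times>\<^sub>t B) \<or> (\<exists>l. M = Blame (A \<times>\<^sub>t B) l)"
    using 8 by blast
  then show ?case
  proof cases
    case 1
    then show ?thesis using 8(1) step.intros(13) value_Prod reducesI by metis
  next
    case 2
    from reduces_frame[OF this frames(7), of B] show ?thesis by (auto intro: typing)
  qed
next
  case (9 M A B)
  consider "is_value M" | "reduces M A \<or> (\<exists>l. M = Blame A l)" using 9 by blast
  then show ?case
  proof cases
    case 1
    then show ?thesis by (auto intro: is_value.intros)
  next
    case 2
    from reduces_frame[OF this frames(8), of B "A +\<^sub>t B"] show ?thesis by (auto intro: typing)
  qed
next
  case (10 M B A)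
  consider "is_value M" | "reduces M B \<or> (\<exists>l. M = Blame B l)" using 10 by blast
  then show ?case
  proof cases
    case 1
    then show ?thesis by (auto intro: is_value.intros)
  next
    case 2
    from reduces_frame[OF this frames(9), of A "A +\<^sub>t B"] show ?thesis by (auto intro: typing)
  qed
next
  case (11 L A A' M B N)
  note L = 11(1) and M = 11(3) and N = 11(5)
  consider "is_value L" | "reduces L (A +\<^sub>t A') \<or> (\<exists>l. L = Blame (A +\<^sub>t A') l)"
    using 11(2) by blast
  then show ?case
  proof cases
    case 1
    \<comment> \<open>The reduct applies a branch to the payload, so the application rule types it
      from the branch typing \<open>M\<close> or \<open>N\<close>.\<close>
    from this L show ?thesis
    proof (cases rule: value_Sum)
      case (InL W)
      then show ?thesis using step.intros(14) typing(4)[OF M] reducesI by metis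
    next
      case (InR W)
      then show ?thesis using step.intros(15) typing(4)[OF N] reducesI by metis
    qed
  next
    case 2
    from reduces_frame[OF this frames(10), of M N B] M N show ?thesis by (auto intro: typing)
  qed
next
  case (12 M A c B)
  consider "is_value M" | "reduces M A \<or> (\<exists>l. M = Blame A l)" using 12 by blast
  then show ?case
  proof cases
    case 1
    then show ?thesis using Cast_reduces 12(1,3) by blast
  next
    case 2
    from reduces_frame[OF this frames(11), of c B] 12(3) show ?thesis by (auto intro: typing)
  qed
\<comment> \<open>Constants and abstractions are values, blame is the third alternative, and no
  variable is typable in the empty context.\<close>
qed (auto intro: is_value.intros)

theorem corollary77:
  fixes M :: "'l::blame_label tm" and A :: ty
  assumes "[] \<turnstile> M : A"
  shows "(\<exists>M'. [] \<turnstile> M' : A \<and> [] \<turnstile> M \<longmapsto> M') \<or> is_value M \<or> (\<exists>l. M = Blame A l)"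
  using progress[OF assms] unfolding reduces_def .

end
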